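(* Let $\rho:[1,\infty)\to(0,\infty)$ be a positive function, let $a>0$ and let $0<\alpha<1$. Suppose that every non-decreasing function $S:[1,\infty)\to\mathbb{R}$ for which the Mellin transform $$G(s)=\int_{1}^{\infty}S(x)x^{-s-1}\,\mathrm{d}x$$ converges for $\operatorname{Re} s>1$ and for which $G(s)-\frac{a}{s-1}$ admits an analytic extension to the half-plane $\operatorname{Re} s>\alpha$ satisfies $$S(x)=ax+O(x\rho(x))\qquad (x\to\infty),$$ where the $O$-constant may depend on $S$. Then $\rho(x)=\Omega(1)$ as $x\to\infty$, that is, $\rho(x)$ does not tend to $0$ as $x\to\infty$.
   Context: The symbol $\Omega$ is the Hardy-Littlewood symbol, i.e. the negation of Landau's $o$: $f(x)=\Omega(g(x))$ means that $f(x)=o(g(x))$ as $x\to\infty$ fails. In particular $\rho(x)=\Omega(1)$ means $\rho(x)\not\to0$, i.e. $\limsup_{x\to\infty}\rho(x)>0$. *)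

theory Defs
  imports "HOL-Complex_Analysis.Complex_Analysis" "HOL-Library.Landau_Symbols"
begin

text \<open>
  Functions on the half-line from 1 to infinity are represented by functions on all reals whose
  values below 1 are irrelevant.  The Mellin transform uses the Henstock--Kurzweil integral on
  the half-line, which exists exactly when the improper integral (the limit of the integrals
  from 1 to X as X tends to infinity) does, with the same value.
\<close>

definition mellin_integrand :: "(real \<Rightarrow> real) \<Rightarrow> complex \<Rightarrow> real \<Rightarrow> complex" where
  "mellin_integrand S s x = of_real (S x) * of_real x powr (- s - 1)"

definition mellin_converges :: "(real \<Rightarrow> real) \<Rightarrow> complex \<Rightarrow> bool" where
  "mellin_converges S s \<longleftrightarrow> mellin_integrand S s integrable_on {1..}"

definition mellin :: "(real \<Rightarrow> real) \<Rightarrow> complex \<Rightarrow> complex" where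
  "mellin S s = integral {1..} (mellin_integrand S s)"

definition has_analytic_extension :: "(complex \<Rightarrow> complex) \<Rightarrow> complex set \<Rightarrow> complex set \<Rightarrow> bool" where
  "has_analytic_extension f A B \<longleftrightarrow>
     A \<subseteq> B \<and> (\<exists>F. F analytic_on B \<and> (\<forall>s\<in>A. F s = f s))"

text \<open>
  The Hardy--Littlewood Omega is the negation of Landau's little-o; it is not the (Knuth) Omega
  of \<^theory>\<open>HOL-Library.Landau_Symbols\<close>, which is an eventual lower bound.
\<close>

definition hl_Omega :: "(real \<Rightarrow> real) \<Rightarrow> (real \<Rightarrow> real) \<Rightarrow> bool" where
  "hl_Omega f g \<longleftrightarrow> f \<notin> o[at_top](g)"

end

theory Submission
  imports Defs "HOL-Real_Asymp.Real_Asymp"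
begin

text \<open>
  If \<open>\<rho>\<close> tended to 0, then \<open>S x = a * x + b * (\<Sum>k. 4 ^ (-k) * (e * ln x / N\<^sub>k) ^ N\<^sub>k * cos (l\<^sub>k * ln x))\<close>
  with \<open>l\<^sub>k = 2 * pi * 2 ^ k\<close> and rapidly growing integers \<open>N\<^sub>k\<close> would contradict the hypothesis.
  Relative to \<open>x\<close>, the \<open>k\<close>-th wave is a bump of height \<open>4 ^ (-k)\<close> at \<open>ln x = N\<^sub>k\<close>, which exceeds every multiple
  of \<open>\<rho>\<close> once \<open>N\<^sub>k\<close> is so large that \<open>\<rho> (exp N\<^sub>k) \<le> 8 ^ (-k)\<close>.  Its derivative is \<open>O(2 ^ (-k))\<close>, so \<open>S\<close>
  is monotone for small \<open>b\<close>.  Its Mellin transform is a combination of \<open>1 / (s \<plusminus> \<i> * l\<^sub>k) ^ (N\<^sub>k + 1)\<close>: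
  the poles lie on \<open>Re s = 0\<close>, and since \<open>l\<^sub>k\<close> tends to infinity the sum over \<open>k\<close> converges locally
  uniformly on \<open>Re s > 0\<close>, however fast \<open>N\<^sub>k\<close> grows.
\<close>

section \<open>Integrals over a half-line and powers of the logarithm\<close>

text \<open>The fundamental theorem of calculus evaluates the integrals of the truncations of
  \<open>f\<close> to \<open>{a..a + real k}\<close>; dominated convergence with majorant
  \<open>h\<close> then lets \<open>k\<close> tend to infinity.\<close>

lemma has_integral_atLeast_antiderivative:
  fixes F f :: "real \<Rightarrow> 'a::euclidean_space"
  assumes deriv: "\<And>x. x \<ge> a \<Longrightarrow> (F has_vector_derivative f x) (at x)"
    and dom: "\<And>x. x \<ge> a \<Longrightarrow> norm (f x) \<le> h x"
    and h: "h integrable_on {a..}"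
    and lim: "(F \<longlongrightarrow> L) at_top"
  shows "(f has_integral L - F a) {a..}"
proof -
  define g where "g = (\<lambda>(k::nat) x. if x \<in> {a..a + real k} then f x else 0)"
  have gint: "(g k has_integral F (a + real k) - F a) {a..}" for k
  proof -
    have "(f has_integral F (a + real k) - F a) {a..a + real k}"
      by (rule fundamental_theorem_of_calculus)
        (auto intro!: has_vector_derivative_at_within deriv)
    then show ?thesis
      unfolding g_def by (subst has_integral_restrict) auto
  qed
  have 1: "g k integrable_on {a..}" for k
    using gint by blast
  have 2: "norm (g k x) \<le> h x" if "x \<in> {a..}" for k x
  proof -
    have "0 \<le> h x"
      using dom[of x] that norm_ge_zero[of "f x"] by (simp del: norm_ge_zero)
    then show ?thesis
      using dom[of x] that by (auto simp: g_def)
  qed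
  have 3: "(\<lambda>k. g k x) \<longlonglongrightarrow> f x" if "x \<in> {a..}" for x
  proof (rule tendsto_eventually)
    have "eventually (\<lambda>k. x - a \<le> real k) sequentially"
      by real_asymp
    then show "eventually (\<lambda>k. g k x = f x) sequentially"
      by eventually_elim (use that in \<open>auto simp: g_def\<close>)
  qed
  note dc = dominated_convergence[OF 1 h 2 3]
  have "(\<lambda>k. F (a + real k) - F a) \<longlonglongrightarrow> integral {a..} f"
    using dc(2) by (simp add: integral_unique[OF gint])
  moreover have "(\<lambda>k. F (a + real k) - F a) \<longlonglongrightarrow> L - F a"
  proof (intro tendsto_intros filterlim_compose[OF lim])
    show "filterlim (\<lambda>k. a + real k) at_top sequentially"
      by real_asymp
  qed
  ultimately have "integral {a..} f = L - F a"
    using LIMSEQ_unique by blast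
  then show ?thesis
    using dc(1) by (metis integrable_integral)
qed

text \<open>The inequality 1 + v \<le> exp v at v = u / n - 1 bounds the base by exp (u / n); raise
  it to the power \<open>m\<close>. For m = n and u = n there is equality, which fixes the
  normalisation of the waves. The case m = n - 1 serves their derivatives.\<close>

lemma exp_linear_power_le_exp:
  fixes u :: real
  assumes "u \<ge> 0" "m \<le> n"
  shows "(exp 1 * u / real n) ^ m \<le> exp u"
proof (cases "n = 0")
  case True
  then show ?thesis
    using assms by simp
next
  case False
  have "u / real n \<le> exp (u / real n - 1)"
    using exp_ge_add_one_self[of "u / real n - 1"] by simp
  then have "exp 1 * u / real n \<le> exp (u / real n)"
    by (simp add: exp_diff field_simps)
  then have "(exp 1 * u / real n) ^ m \<le> exp (u / real n) ^ m"
    using assms by (intro power_mono) auto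
  also have "\<dots> = exp (real m * (u / real n))"
    using exp_of_nat_mult[of m "u / real n"] by simp
  also have "real m * (u / real n) \<le> real n * (u / real n)"
    using assms by (intro mult_right_mono) auto
  also have "real n * (u / real n) = u"
    using False by simp
  finally show ?thesis
    by simp
qed

lemma ln_power_le_powr:
  assumes "\<delta> > 0"
  obtains K :: real where "K \<ge> 0" "\<And>x. x \<ge> 1 \<Longrightarrow> ln x ^ n \<le> K * x powr \<delta>"
proof (cases "n = 0")
  case True
  show ?thesis
    using assms by (intro that[of 1]) (auto simp: True intro!: ge_one_powr_ge_zero)
next
  case False
  define K where "K = (real n / (exp 1 * \<delta>)) ^ n"
  show ?thesis
  proof (rule that)
    show "K \<ge> 0"
      using assms by (simp add: K_def)
    fix x :: real assume x: "x \<ge> 1"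
    have "ln x ^ n = K * (exp 1 * (\<delta> * ln x) / real n) ^ n"
      using assms False by (simp add: K_def flip: power_mult_distrib)
    also have "\<dots> \<le> K * exp (\<delta> * ln x)"
      using assms x by (intro mult_left_mono exp_linear_power_le_exp) (auto simp: K_def)
    finally show "ln x ^ n \<le> K * x powr \<delta>"
      using x by (simp add: powr_def)
  qed
qed

text \<open>Half of the exponent is spent on absorbing the logarithms. The other half remains as
  decay, enough for the limit at infinity and, after division by \<open>x\<close>, for
  integrability.\<close>

lemma norm_ln_power_powr_le:
  fixes w :: complex
  assumes "Re w > 0"
  obtains K :: real where "\<And>x. x \<ge> 1 \<Longrightarrow>
    norm (of_real (ln x) ^ n * of_real x powr (- w)) \<le> K * x powr (- (Re w / 2))"
proof -
  from assms obtain K :: real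
    where K: "\<And>x. x \<ge> 1 \<Longrightarrow> ln x ^ n \<le> K * x powr (Re w / 2)"
    using ln_power_le_powr[of "Re w / 2" n] by auto
  show ?thesis
  proof (rule that)
    fix x :: real assume x: "x \<ge> 1"
    have "norm (of_real (ln x) ^ n * of_real x powr (- w)) = ln x ^ n * x powr (- Re w)"
      using x by (simp add: norm_mult norm_power norm_powr_real_powr)
    also have "\<dots> \<le> K * x powr (Re w / 2) * x powr (- Re w)"
      using K[OF x] by (intro mult_right_mono) auto
    also have "\<dots> = K * x powr (- (Re w / 2))"
      by (simp add: mult.assoc flip: powr_add)
    finally show "norm (of_real (ln x) ^ n * of_real x powr (- w))
        \<le> K * x powr (- (Re w / 2))" .
  qed
qed

lemma tendsto_ln_power_powr:
  fixes w :: complex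
  assumes "Re w > 0"
  shows "((\<lambda>x. of_real (ln x) ^ n * of_real x powr (- w)) \<longlongrightarrow> 0) at_top"
proof -
  obtain K :: real where K: "\<And>x. x \<ge> 1 \<Longrightarrow>
      norm (of_real (ln x) ^ n * of_real x powr (- w)) \<le> K * x powr (- (Re w / 2))"
    using norm_ln_power_powr_le[OF assms, of n] by blast
  show ?thesis
  proof (rule Lim_null_comparison)
    show "eventually (\<lambda>x. norm (of_real (ln x) ^ n * of_real x powr (- w))
        \<le> K * x powr (- (Re w / 2))) at_top"
      using eventually_ge_at_top[of 1] by eventually_elim (rule K)
    show "((\<lambda>x. K * x powr (- (Re w / 2))) \<longlongrightarrow> 0) at_top"
      using assms
      by (intro tendsto_mult_right_zero tendsto_neg_powr filterlim_ident) auto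
  qed
qed

lemma has_vector_derivative_of_real_powr:
  fixes w :: complex
  assumes "x > 0"
  shows "((\<lambda>x. of_real x powr w) has_vector_derivative w * of_real x powr (w - 1)) (at x)"
  using assms
  by (intro has_vector_derivative_real_field has_field_derivative_powr) auto

text \<open>This is the Gamma integral after the substitution u = ln x, proved by induction on
  \<open>n\<close> with integration by parts.\<close>

lemma ln_power_powr_has_integral:
  fixes w :: complex
  assumes w: "Re w > 0"
  shows "((\<lambda>x. of_real (ln x) ^ n * of_real x powr (- w - 1)) has_integral
    fact n / w ^ Suc n) {1..}"
proof -
  have [simp]: "w \<noteq> 0"
    using w by auto
  have dom: "\<exists>h. h integrable_on {1..} \<and>
      (\<forall>x\<ge>1. norm (of_real (ln x) ^ n * of_real x powr (- w - 1)) \<le> h x)" for n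
  proof -
    obtain K :: real where K: "\<And>x. x \<ge> 1 \<Longrightarrow>
        norm (of_real (ln x) ^ n * of_real x powr (- w)) \<le> K * x powr (- (Re w / 2))"
      using norm_ln_power_powr_le[OF assms, of n] by blast
    have "norm (of_real (ln x) ^ n * of_real x powr (- w - 1)) \<le> K * x powr (- (Re w / 2) - 1)"
      if "x \<ge> 1" for x
    proof -
      have "norm (of_real (ln x) ^ n * of_real x powr (- w - 1)) =
          norm (of_real (ln x) ^ n * of_real x powr (- w)) / x"
        using that by (simp add: powr_diff norm_mult norm_divide)
      also have "\<dots> \<le> K * x powr (- (Re w / 2)) / x"
        using that by (intro divide_right_mono K) auto
      also have "\<dots> = K * x powr (- (Re w / 2) - 1)"
        using that by (simp add: powr_diff)
      finally show ?thesis .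
    qed
    moreover have "(\<lambda>x. K * x powr (- (Re w / 2) - 1)) integrable_on {1..}"
      using has_integral_mult_right[OF has_integral_powr_to_inf[of "- (Re w / 2) - 1" 1]] w
      by (auto simp: integrable_on_def)
    ultimately show ?thesis
      by (intro exI[of _ "\<lambda>x. K * x powr (- (Re w / 2) - 1)"]) auto
  qed
  show ?thesis
  proof (induction n)
    \<comment> \<open>Here the boundary term at 1 does not vanish; it supplies the value 1 /
      w.\<close>
    case 0
    obtain h where h: "h integrable_on {1..}"
        "\<And>x. x \<ge> 1 \<Longrightarrow> norm (of_real x powr (- w - 1)) \<le> h x"
      using dom[of 0] by auto
    have "((\<lambda>x. of_real x powr (- w - 1)) has_integral
        0 - (\<lambda>x. of_real x powr (- w) / (- w)) (1::real)) {1..}"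
    proof (rule has_integral_atLeast_antiderivative[OF _ _ h(1)])
      fix x :: real assume x: "x \<ge> 1"
      have "((\<lambda>x. of_real x powr (- w) * (1 / (- w))) has_vector_derivative
          (- w * of_real x powr (- w - 1)) * (1 / (- w))) (at x)"
        using x by (intro has_vector_derivative_mult_left has_vector_derivative_of_real_powr) auto
      then show "((\<lambda>x. of_real x powr (- w) / (- w)) has_vector_derivative
          of_real x powr (- w - 1)) (at x)"
        by simp
      show "norm (of_real x powr (- w - 1)) \<le> h x"
        by (rule h(2)[OF x])
    next
      show "((\<lambda>x. of_real x powr (- w) / (- w)) \<longlongrightarrow> 0) at_top"
        using tendsto_divide[OF tendsto_ln_power_powr[OF w, of 0] tendsto_const[of "- w"]] by simp
    qed
    then show ?case
      by simp
  next
    case (Suc n)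
    let ?f = "\<lambda>n x. of_real (ln x) ^ n * of_real x powr (- w - 1) :: complex"
    \<comment> \<open>The derivative of ln x ^ (n + 1) * x powr (- w). This function vanishes at 1,
      since ln 1 = 0, and at infinity, so \<open>?d\<close> has integral 0, which is the recursion
      between consecutive powers.\<close>
    let ?d = "\<lambda>x. of_nat (Suc n) * ?f n x - w * ?f (Suc n) x"
    obtain h1 where h1: "h1 integrable_on {1..}" "\<And>x. x \<ge> 1 \<Longrightarrow> norm (?f n x) \<le> h1 x"
      using dom[of n] by auto
    obtain h2 where h2: "h2 integrable_on {1..}" "\<And>x. x \<ge> 1 \<Longrightarrow> norm (?f (Suc n) x) \<le> h2 x"
      using dom[of "Suc n"] by auto
    have "(?d has_integral
        0 - (\<lambda>x. of_real (ln x) ^ Suc n * of_real x powr (- w)) (1::real)) {1..}"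
    proof (rule has_integral_atLeast_antiderivative)
      show "(\<lambda>x. real (Suc n) * h1 x + norm w * h2 x) integrable_on {1..}"
        using h1(1) h2(1) by (intro integrable_add integrable_on_mult_right)
      show "((\<lambda>x. of_real (ln x) ^ Suc n * of_real x powr (- w)) \<longlongrightarrow> 0) at_top"
        by (rule tendsto_ln_power_powr[OF w])
      fix x :: real assume x: "x \<ge> 1"
      have "norm (?d x) \<le> norm (of_nat (Suc n) * ?f n x) + norm (w * ?f (Suc n) x)"
        by (rule norm_triangle_ineq4)
      also have "\<dots> \<le> real (Suc n) * h1 x + norm w * h2 x"
        unfolding norm_mult[of "of_nat (Suc n)"] norm_mult[of w] norm_of_nat
        by (intro add_mono mult_left_mono h1(2) h2(2) x) auto
      finally show "norm (?d x) \<le> real (Suc n) * h1 x + norm w * h2 x" .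
      have "((\<lambda>x. ln x ^ Suc n) has_real_derivative real (Suc n) * ln x ^ n / x) (at x)"
        using DERIV_power[OF DERIV_ln_divide, of x "Suc n"] x by simp
      then have "((\<lambda>x. complex_of_real (ln x ^ Suc n)) has_vector_derivative
          of_real (real (Suc n) * ln x ^ n / x)) (at x)"
        by (intro has_vector_derivative_of_real) (simp add: has_real_derivative_iff_has_vector_derivative)
      then have "((\<lambda>x. complex_of_real (ln x ^ Suc n) * of_real x powr (- w)) has_vector_derivative
          of_real (ln x ^ Suc n) * (- w * of_real x powr (- w - 1)) +
          of_real (real (Suc n) * ln x ^ n / x) * of_real x powr (- w)) (at x)"
        using x by (intro has_vector_derivative_mult has_vector_derivative_of_real_powr) auto
      then show "((\<lambda>x. of_real (ln x) ^ Suc n * of_real x powr (- w)) has_vector_derivative ?d x) (at x)"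
        using x by (simp add: powr_diff field_simps)
    qed
    then have "(?d has_integral 0) {1..}"
      by simp
    from has_integral_diff[OF has_integral_mult_right[OF Suc.IH, of "of_nat (Suc n)"] this]
    have "((\<lambda>x. w * ?f (Suc n) x) has_integral of_nat (Suc n) * (fact n / w ^ Suc n)) {1..}"
      by simp
    from has_integral_mult_right[OF this, of "1 / w"] show ?case
      by (simp add: field_simps)
  qed
qed

section \<open>A single wave: size, slope and Mellin transform\<close>

text \<open>The factor exp 1 / n makes the envelope touch \<open>x\<close> from below at ln x = n,
  for every \<open>n\<close>; for n = 0 the envelope is the constant 1.\<close>

definition wave :: "nat \<Rightarrow> real \<Rightarrow> real \<Rightarrow> real" where
  "wave n l x = (exp 1 * ln x / real n) ^ n * cos (l * ln x)"

definition wave_mellin :: "nat \<Rightarrow> real \<Rightarrow> complex \<Rightarrow> complex" where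
  "wave_mellin n l s = of_real ((exp 1 / real n) ^ n * fact n / 2) *
     (1 / (s - \<i> * of_real l) ^ Suc n + 1 / (s + \<i> * of_real l) ^ Suc n)"

lemma abs_wave_le:
  assumes "x \<ge> 1"
  shows "\<bar>wave n l x\<bar> \<le> x"
proof -
  have "\<bar>wave n l x\<bar> = (exp 1 * ln x / real n) ^ n * \<bar>cos (l * ln x)\<bar>"
    using assms by (simp add: wave_def abs_mult)
  also have "\<dots> \<le> exp (ln x) * 1"
    using assms by (intro mult_mono exp_linear_power_le_exp) auto
  finally show ?thesis
    using assms by simp
qed

text \<open>Differentiating the envelope contributes at most exp 1 \<le> 3 to the slope,
  differentiating the cosine at most \<open>l\<close>. Both bounds are uniform in \<open>n\<close>,
  which later leaves the peak positions free.\<close>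

lemma mono_on_linear_plus_wave:
  assumes "l \<ge> 0"
  shows "mono_on {1..} (\<lambda>x. (3 + l) * x + wave n l x)"
proof (rule mono_onI)
  fix x y :: real
  assume xy: "x \<in> {1..}" "y \<in> {1..}" "x \<le> y"
  show "(3 + l) * x + wave n l x \<le> (3 + l) * y + wave n l y"
  proof (rule DERIV_nonneg_imp_nondecreasing[OF xy(3)])
    fix t assume "x \<le> t" "t \<le> y"
    with xy have t: "t \<ge> 1"
      by auto
    let ?b = "exp 1 * ln t / real n"
    let ?A = "real n * ?b ^ (n - 1) * (exp 1 / (real n * t)) * cos (l * ln t)"
    let ?B = "?b ^ n * (sin (l * ln t) * (l / t))"
    have 1: "((\<lambda>x. exp 1 * ln x / real n) has_real_derivative exp 1 / (real n * t)) (at t)"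
      using t by (cases "n = 0") (auto intro!: derivative_eq_intros)
    have 2: "((\<lambda>x. cos (l * ln x)) has_real_derivative - (sin (l * ln t) * (l / t))) (at t)"
      using t by (auto intro!: derivative_eq_intros)
    have 3: "((\<lambda>x. (3 + l) * x) has_real_derivative 3 + l) (at t)"
      by (auto intro!: derivative_eq_intros)
    have deriv: "((\<lambda>x. (3 + l) * x + wave n l x) has_real_derivative (3 + l) + (?A - ?B)) (at t)"
      unfolding wave_def
      by (rule DERIV_cong[OF DERIV_add[OF 3 DERIV_mult[OF DERIV_power[OF 1] 2]]])
        (simp add: mult_ac)
    have A: "\<bar>?A\<bar> \<le> 3"
    proof (cases "n = 0")
      case False
      \<comment> \<open>The factor \<open>n\<close> from the power rule cancels the one in the inner
        derivative; the remaining power is at most exp (ln t) = t, which cancels 1 / t.\<close>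
      have "\<bar>?A\<bar> = ?b ^ (n - 1) * (exp 1 / t) * \<bar>cos (l * ln t)\<bar>"
        using t False by (simp add: abs_mult)
      also have "\<dots> \<le> exp (ln t) * (exp 1 / t) * 1"
        using t by (intro mult_mono exp_linear_power_le_exp) auto
      also have "\<dots> \<le> 3"
        using t exp_le by simp
      finally show ?thesis .
    qed simp
    have nonneg: "0 \<le> (3 + l) + (?A - ?B)"
    proof -
      have "\<bar>?B\<bar> = ?b ^ n * (\<bar>sin (l * ln t)\<bar> * (l / t))"
        using t assms by (simp add: abs_mult)
      also have "\<dots> \<le> exp (ln t) * (1 * (l / t))"
        using t assms by (intro mult_mono exp_linear_power_le_exp) auto
      also have "\<dots> = l"
        using t by simp
      finally show ?thesis
        using A by linarith
    qed
    show "\<exists>d. ((\<lambda>x. (3 + l) * x + wave n l x) has_real_derivative d) (at t) \<and> 0 \<le> d"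
      using deriv nonneg by blast
  qed
qed

text \<open>Euler's formula splits the cosine into imaginary powers of \<open>x\<close>. They shift
  \<open>s\<close> by - i l and + i l without changing its real part, so the Gamma integral applies
  to both halves.\<close>

lemma wave_has_mellin:
  assumes "Re s > 0"
  shows "(mellin_integrand (wave n l) s has_integral wave_mellin n l s) {1..}"
proof -
  let ?c = "complex_of_real ((exp 1 / real n) ^ n / 2)"
  let ?k = "\<lambda>w x. of_real (ln x) ^ n * of_real x powr (- w - 1) :: complex"
  have eq: "mellin_integrand (wave n l) s x =
      ?c * (?k (s - \<i> * of_real l) x + ?k (s + \<i> * of_real l) x)" if "x \<ge> 1" for x
  proof -
    have cos: "complex_of_real (cos (l * ln x)) =
        (exp (\<i> * of_real l * of_real (ln x)) + exp (- (\<i> * of_real l * of_real (ln x)))) / 2"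
      by (simp add: cos_exp_eq mult.assoc flip: cos_of_real)
    have "of_real x powr (- (s - \<i> * of_real l) - 1) =
        of_real x powr (- s - 1) * exp (\<i> * of_real l * of_real (ln x))"
      using that by (simp add: powr_def Ln_of_real algebra_simps flip: exp_add)
    moreover have "of_real x powr (- (s + \<i> * of_real l) - 1) =
        of_real x powr (- s - 1) * exp (- (\<i> * of_real l * of_real (ln x)))"
      using that by (simp add: powr_def Ln_of_real algebra_simps flip: exp_add)
    moreover have "complex_of_real ((exp 1 * ln x / real n) ^ n) =
        2 * ?c * of_real (ln x) ^ n"
      by (simp add: power_divide power_mult_distrib)
    ultimately show ?thesis
      unfolding mellin_integrand_def wave_def of_real_mult cos
      by (simp add: algebra_simps add_divide_distrib)
  qed
  have "((\<lambda>x. ?c * (?k (s - \<i> * of_real l) x + ?k (s + \<i> * of_real l) x)) has_integral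
      ?c * (fact n / (s - \<i> * of_real l) ^ Suc n + fact n / (s + \<i> * of_real l) ^ Suc n)) {1..}"
    using assms
    by (intro has_integral_mult_right has_integral_add ln_power_powr_has_integral) auto
  also have "?c * (fact n / (s - \<i> * of_real l) ^ Suc n + fact n / (s + \<i> * of_real l) ^ Suc n) =
      wave_mellin n l s"
    by (simp add: wave_mellin_def field_simps)
  finally show ?thesis
    by (rule has_integral_eq[rotated]) (simp add: eq)
qed

lemma wave_mellin_holomorphic:
  "wave_mellin n l holomorphic_on {s. Re s > 0}"
proof -
  have "s - \<i> * of_real l \<noteq> 0" "s + \<i> * of_real l \<noteq> 0" if "Re s > 0" for s
    using that by (auto simp: complex_eq_iff)
  then show ?thesis
    unfolding wave_mellin_def by (intro holomorphic_intros) auto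
qed

text \<open>Both poles are at distance at least exp 1 from \<open>s\<close>, so each reciprocal
  power is at most exp (- n), while fact n \<le> n ^ n bounds the coefficient by exp n / 2. The two
  exponentials cancel whatever \<open>n\<close> is.\<close>

lemma norm_wave_mellin_le_1:
  assumes "exp 1 + norm s \<le> l"
  shows "norm (wave_mellin n l s) \<le> 1"
proof -
  have norms: "exp 1 \<le> norm (s - \<i> * of_real l)" "exp 1 \<le> norm (s + \<i> * of_real l)"
    using assms norm_triangle_ineq2[of "\<i> * of_real l" s] norm_triangle_ineq2[of "\<i> * of_real l" "- s"]
    by (auto simp: norm_mult norm_minus_commute add.commute)
  have inv: "norm (1 / z ^ Suc n) \<le> 1 / exp 1 ^ n" if "exp 1 \<le> norm z" for z :: complex
  proof -
    \<comment> \<open>One of the n + 1 factors is given away, as exp 1 \<ge> 1.\<close>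
    have "exp 1 ^ n \<le> (exp 1 ^ Suc n :: real)"
      by (intro power_increasing) auto
    also have "\<dots> \<le> norm z ^ Suc n"
      using that by (intro power_mono) auto
    finally show ?thesis
      unfolding norm_divide norm_power norm_one
      by (intro divide_left_mono mult_pos_pos) (auto intro: less_le_trans[of _ "exp 1 ^ n"])
  qed
  have fact: "(exp 1 / real n) ^ n * fact n \<le> exp 1 ^ n"
  proof (cases "n = 0")
    case False
    have "(exp 1 / real n) ^ n * fact n \<le> (exp 1 / real n) ^ n * real (n ^ n)"
      by (intro mult_left_mono fact_le_power) auto
    also have "\<dots> = exp 1 ^ n"
      using False by (simp add: power_divide)
    finally show ?thesis .
  qed simp
  have coeff: "norm (complex_of_real ((exp 1 / real n) ^ n * fact n / 2)) \<le> exp 1 ^ n / 2"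
    unfolding norm_of_real using fact by simp
  have "norm (wave_mellin n l s) \<le> exp 1 ^ n / 2 * (1 / exp 1 ^ n + 1 / exp 1 ^ n)"
    unfolding wave_mellin_def norm_mult
    by (intro mult_mono order_trans[OF norm_triangle_ineq] add_mono inv norms coeff) auto
  then show ?thesis
    by simp
qed

section \<open>Superposition of the waves\<close>

text \<open>The growth 2 ^ k drives the poles out of every bounded set, yet is slow enough for the
  weights 4 ^ (-k) to keep the total slope finite.\<close>

definition freq :: "nat \<Rightarrow> real" where
  "freq k = 2 * pi * 2 ^ k"

definition osc :: "(nat \<Rightarrow> nat) \<Rightarrow> real \<Rightarrow> real" where
  "osc N x = (\<Sum>k. (1/4) ^ k * wave (N k) (freq k) x)"

definition osc_mellin :: "(nat \<Rightarrow> nat) \<Rightarrow> complex \<Rightarrow> complex" where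
  "osc_mellin N s = (\<Sum>k. (1/4) ^ k * wave_mellin (N k) (freq k) s)"

lemma osc_summable:
  assumes "x \<ge> 1"
  shows "summable (\<lambda>k. (1/4) ^ k * wave (N k) (freq k) x)"
proof (rule summable_comparison_test)
  show "\<exists>K. \<forall>k\<ge>K. norm ((1/4) ^ k * wave (N k) (freq k) x) \<le> (1/4) ^ k * x"
    using assms by (auto simp: abs_mult intro!: mult_left_mono abs_wave_le)
  show "summable (\<lambda>k. (1/4) ^ k * x)"
    by (intro summable_mult2 summable_geometric) auto
qed

text \<open>The slopes that make the single waves monotone add up, with their weights, to a
  convergent series, its sum being \<open>D\<close>. Monotonicity passes to the sum termwise,
  without differentiating the series.\<close>

lemma mono_on_linear_plus_osc:
  obtains D where "D > 0" "mono_on {1..} (\<lambda>x. D * x + osc N x)"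
proof -
  define d where "d = (\<lambda>k. (1/4) ^ k * (3 + freq k))"
  have d_eq: "d k = 3 * (1/4) ^ k + 2 * pi * (1/2) ^ k" for k
  proof -
    have "(1/4 :: real) ^ k * 2 ^ k = (1/2) ^ k"
      by (simp flip: power_mult_distrib)
    then show ?thesis
      by (simp add: d_def freq_def algebra_simps)
  qed
  have sd: "summable d"
    unfolding d_eq[abs_def] by (intro summable_add summable_mult summable_geometric) auto
  have pos: "d k > 0" for k
    by (auto simp: d_eq intro!: add_pos_pos)
  show ?thesis
  proof (rule that)
    show "suminf d > 0"
      using suminf_pos[OF sd pos] .
    have eq: "suminf d * x + osc N x = (\<Sum>k. (1/4) ^ k * ((3 + freq k) * x + wave (N k) (freq k) x))"
      and sm: "summable (\<lambda>k. (1/4) ^ k * ((3 + freq k) * x + wave (N k) (freq k) x))"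
      if "x \<ge> 1" for x
    proof -
      have *: "(\<lambda>k. d k * x + (1/4) ^ k * wave (N k) (freq k) x) sums (suminf d * x + osc N x)"
        unfolding osc_def
        by (intro sums_add sums_mult2 summable_sums sd osc_summable that)
      have **: "d k * x + (1/4) ^ k * wave (N k) (freq k) x =
          (1/4) ^ k * ((3 + freq k) * x + wave (N k) (freq k) x)" for k
        by (simp add: d_def algebra_simps)
      show "suminf d * x + osc N x = (\<Sum>k. (1/4) ^ k * ((3 + freq k) * x + wave (N k) (freq k) x))"
        and "summable (\<lambda>k. (1/4) ^ k * ((3 + freq k) * x + wave (N k) (freq k) x))"
        using * unfolding ** by (auto simp: sums_iff)
    qed
    show "mono_on {1..} (\<lambda>x. suminf d * x + osc N x)"
    proof (rule mono_onI)
      fix x y :: real assume xy: "x \<in> {1..}" "y \<in> {1..}" "x \<le> y"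
      have "freq k \<ge> 0" for k
        by (simp add: freq_def)
      from mono_onD[OF mono_on_linear_plus_wave[OF this] xy]
      show "suminf d * x + osc N x \<le> suminf d * y + osc N y"
        using xy by (auto simp: eq intro!: suminf_le sm mult_left_mono)
    qed
  qed
qed

text \<open>Dominated convergence for the partial sums: each wave is at most \<open>x\<close> in
  modulus and the weights sum to 4/3 < 2, which gives a majorant integrable for Re s > 1.\<close>

lemma osc_has_mellin:
  assumes "Re s > 1"
  shows "(mellin_integrand (osc N) s has_integral osc_mellin N s) {1..}"
proof -
  define f where "f = (\<lambda>m x. \<Sum>k<m. (1/4) ^ k * mellin_integrand (wave (N k) (freq k)) s x)"
  have fint: "(f m has_integral (\<Sum>k<m. (1/4) ^ k * wave_mellin (N k) (freq k) s)) {1..}" for m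
    unfolding f_def using assms
    by (intro has_integral_sum has_integral_mult_right wave_has_mellin) auto
  have 1: "f m integrable_on {1..}" for m
    using fint by blast
  have 2: "(\<lambda>x. 2 * x powr (- Re s)) integrable_on {1..}"
    using has_integral_mult_right[OF has_integral_powr_to_inf[of "- Re s" 1]] assms
    by (auto simp: integrable_on_def)
  have feq: "f m x = of_real (\<Sum>k<m. (1/4) ^ k * wave (N k) (freq k) x) * of_real x powr (- s - 1)" for m x
    by (simp add: f_def mellin_integrand_def sum_distrib_right mult.assoc)
  have 3: "norm (f m x) \<le> 2 * x powr (- Re s)" if "x \<in> {1..}" for m x
  proof -
    have "\<bar>\<Sum>k<m. (1/4) ^ k * wave (N k) (freq k) x\<bar> \<le> (\<Sum>k<m. (1/4) ^ k * x)"
      using that by (intro order_trans[OF sum_abs] sum_mono) (auto simp: abs_mult intro!: mult_left_mono abs_wave_le)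
    also have "\<dots> = (\<Sum>k<m. (1/4) ^ k) * x"
      by (simp add: sum_distrib_right)
    also have "(\<Sum>k<m. (1/4) ^ k :: real) \<le> 2"
      using zero_le_power[of "1/4 :: real" m] by (simp add: sum_gp_strict del: zero_le_power)
    finally have "\<bar>\<Sum>k<m. (1/4) ^ k * wave (N k) (freq k) x\<bar> \<le> 2 * x"
      using that by simp
    then have "norm (f m x) \<le> 2 * x * x powr (- Re s - 1)"
      unfolding feq norm_mult norm_of_real using that
      by (intro mult_mono) (auto simp: norm_powr_real_powr)
    also have "\<dots> = 2 * x powr (- Re s)"
      using that by (simp add: powr_diff)
    finally show ?thesis .
  qed
  have 4: "(\<lambda>m. f m x) \<longlonglongrightarrow> mellin_integrand (osc N) s x" if "x \<in> {1..}" for x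
    unfolding feq mellin_integrand_def osc_def using that
    by (intro tendsto_intros summable_LIMSEQ osc_summable) auto
  note dc = dominated_convergence[OF 1 2 3 4]
  have "(\<lambda>k. (1/4) ^ k * wave_mellin (N k) (freq k) s) sums integral {1..} (mellin_integrand (osc N) s)"
    using dc(2) by (simp add: sums_def integral_unique[OF fint])
  then have "osc_mellin N s = integral {1..} (mellin_integrand (osc N) s)"
    by (simp add: osc_mellin_def sums_iff)
  then show ?thesis
    using dc(1) by (metis integrable_integral)
qed

text \<open>Weierstrass M-test on closed discs in the half-plane.\<close>

lemma osc_mellin_holomorphic:
  "osc_mellin N holomorphic_on {s. Re s > 0}"
proof (rule holomorphic_uniform_sequence)
  show "open {s. Re s > 0}"
    by (rule open_halfspace_Re_gt)
  show "(\<lambda>s. \<Sum>k<m. (1/4) ^ k * wave_mellin (N k) (freq k) s) holomorphic_on {s. Re s > 0}" for m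
    by (intro holomorphic_intros wave_mellin_holomorphic)
  fix z :: complex assume "z \<in> {s. Re s > 0}"
  then obtain d where d: "d > 0" "cball z d \<subseteq> {s. Re s > 0}"
    using open_halfspace_Re_gt open_contains_cball by metis
  \<comment> \<open>For all but finitely many \<open>k\<close> the poles are so far from the disc
    that the transforms are bounded by 1 there; the finitely many other terms do not affect uniform
    convergence.\<close>
  have ev: "eventually (\<lambda>k. exp 1 + (norm z + d) \<le> freq k) sequentially"
    unfolding freq_def by real_asymp
  have "uniform_limit (cball z d) (\<lambda>m s. \<Sum>k<m. (1/4) ^ k * wave_mellin (N k) (freq k) s)
      (\<lambda>s. \<Sum>k. (1/4) ^ k * wave_mellin (N k) (freq k) s) sequentially"
  proof (rule Weierstrass_m_test_ev)
    show "\<forall>\<^sub>F k in sequentially. \<forall>s\<in>cball z d. norm ((1/4) ^ k * wave_mellin (N k) (freq k) s) \<le> (1/4) ^ k"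
      using ev
    proof eventually_elim
      case (elim k)
      show ?case
      proof
        fix s assume "s \<in> cball z d"
        then have "norm s \<le> norm z + d"
          using norm_triangle_ineq2[of s z] by (simp add: dist_norm norm_minus_commute)
        with elim have "norm (wave_mellin (N k) (freq k) s) \<le> 1"
          by (intro norm_wave_mellin_le_1) auto
        then show "norm ((1/4) ^ k * wave_mellin (N k) (freq k) s) \<le> (1/4) ^ k"
          by (simp add: norm_mult norm_power norm_divide field_simps)
      qed
    qed
    show "summable (\<lambda>k. (1/4) ^ k :: real)"
      by (rule summable_geometric) auto
  qed
  then show "\<exists>d>0. cball z d \<subseteq> {s. Re s > 0} \<and>
      uniform_limit (cball z d) (\<lambda>m s. \<Sum>k<m. (1/4) ^ k * wave_mellin (N k) (freq k) s)
        (osc_mellin N) sequentially"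
    using d unfolding osc_mellin_def[abs_def] by blast
qed

section \<open>Peaks against the rate\<close>

text \<open>
  The frequencies are integer multiples of \<open>2 * pi\<close> and the peaks sit at integer values of \<open>ln x\<close>,
  so no wave can cancel another one there.
\<close>
lemma osc_peak:
  "(1/4) ^ k * exp (real (N k)) \<le> osc N (exp (real (N k)))"
proof -
  have cos: "cos (freq j * real m) = 1" for j m
    using cos_int_2pin[of "int (2 ^ j * m)"] by (simp add: freq_def mult.assoc)
  have "(1/4) ^ k * exp (real (N k)) = (1/4) ^ k * wave (N k) (freq k) (exp (real (N k)))"
    \<comment> \<open>At ln x = N k the base of the envelope is exp 1. For N k = 0 the quotient is 0
      by convention, but its zeroth power is still 1 = exp 0.\<close>
    by (cases "N k = 0") (simp_all add: wave_def cos exp_of_nat_mult flip: exp_of_nat_mult)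
  also have "\<dots> = (\<Sum>j\<in>{k}. (1/4) ^ j * wave (N j) (freq j) (exp (real (N k))))"
    by simp
  also have "\<dots> \<le> osc N (exp (real (N k)))"
    unfolding osc_def by (intro sum_le_suminf osc_summable) (auto simp: wave_def cos)
  finally show ?thesis .
qed

text \<open>At the \<open>k\<close>-th peak an O-bound with constant \<open>c\<close> would give 4 ^
  (-k) \<le> c * 8 ^ (-k), hence 2 ^ k \<le> c, which fails for large \<open>k\<close>.\<close>

lemma peaks_exceed_rate:
  fixes \<rho> :: "real \<Rightarrow> real"
  assumes lim: "(\<rho> \<longlongrightarrow> 0) at_top" and pos: "\<And>x. x \<ge> 1 \<Longrightarrow> \<rho> x > 0"
  obtains N where "osc N \<notin> O[at_top](\<lambda>x. x * \<rho> x)"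
proof -
  \<comment> \<open>The condition n \<ge> k sends the peaks to infinity, where the O-estimate can be
    evaluated.\<close>
  have "\<exists>n\<ge>k. \<rho> (exp (real n)) \<le> (1/8) ^ k" for k
  proof -
    have "((\<lambda>n. \<rho> (exp (real n))) \<longlongrightarrow> 0) sequentially"
      by (rule filterlim_compose[OF lim]) real_asymp
    then have "eventually (\<lambda>n. \<rho> (exp (real n)) < (1/8) ^ k) sequentially"
      by (rule order_tendstoD) simp
    from eventually_conj[OF this eventually_ge_at_top[of k]] show ?thesis
      by (auto simp: eventually_sequentially) (meson le_refl less_imp_le)
  qed
  then obtain N where N: "\<And>k. N k \<ge> k" "\<And>k. \<rho> (exp (real (N k))) \<le> (1/8) ^ k"
    by metis
  have "osc N \<notin> O[at_top](\<lambda>x. x * \<rho> x)"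
  proof
    assume "osc N \<in> O[at_top](\<lambda>x. x * \<rho> x)"
    then obtain c where c: "c > 0"
      "eventually (\<lambda>x. norm (osc N x) \<le> c * norm (x * \<rho> x)) at_top"
      by (rule landau_o.bigE)
    have "filterlim (\<lambda>k. exp (real (N k))) at_top sequentially"
    proof (rule filterlim_at_top_mono)
      show "filterlim (\<lambda>k. exp (real k)) at_top sequentially"
        by real_asymp
    qed (use N(1) in auto)
    from eventually_compose_filterlim[OF c(2) this]
    have "eventually (\<lambda>k. 2 ^ k \<le> c) sequentially"
    proof eventually_elim
      case (elim k)
      let ?x = "exp (real (N k))"
      have "(1/4) ^ k * ?x \<le> osc N ?x"
        by (rule osc_peak)
      also have "\<dots> \<le> c * norm (?x * \<rho> ?x)"
        using elim by simp
      also have "\<dots> = c * (?x * \<rho> ?x)"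
        using pos[of ?x] by (simp add: abs_mult)
      also have "\<dots> \<le> c * (?x * (1/8) ^ k)"
        using N(2)[of k] c(1) by (intro mult_left_mono) auto
      finally have "(1/4) ^ k \<le> c * (1/8) ^ k"
        by (simp add: field_simps)
      then have "(1/4 :: real) ^ k * 8 ^ k \<le> c * ((1/8) ^ k * 8 ^ k)"
        using mult_right_mono[of "(1/4) ^ k" "c * (1/8) ^ k" "8 ^ k"] by (simp only: mult.assoc) simp
      also have "(1/4 :: real) ^ k * 8 ^ k = 2 ^ k"
        by (simp flip: power_mult_distrib)
      also have "(1/8 :: real) ^ k * 8 ^ k = 1"
        by (simp flip: power_mult_distrib)
      finally show ?case
        by simp
    qed
    moreover have "eventually (\<lambda>k. 2 ^ k > c) sequentially"
      by real_asymp
    ultimately have "eventually (\<lambda>k. False) sequentially"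
      by eventually_elim simp
    then show False
      by simp
  qed
  then show ?thesis
    by (rule that)
qed

section \<open>The linear term and the counterexample\<close>

lemma linear_has_mellin:
  assumes "Re s > 1"
  shows "(mellin_integrand (\<lambda>x. a * x) s has_integral of_real a / (s - 1)) {1..}"
proof -
  have "((\<lambda>x. of_real a * of_real x powr (- (s - 1) - 1)) has_integral of_real a * (1 / (s - 1))) {1..}"
    using ln_power_powr_has_integral[of "s - 1" 0] assms
    by (intro has_integral_mult_right) auto
  then have "((\<lambda>x. of_real a * of_real x powr (- (s - 1) - 1)) has_integral of_real a / (s - 1)) {1..}"
    by simp
  then show ?thesis
    by (rule has_integral_eq[rotated]) (auto simp: mellin_integrand_def powr_diff)
qed

lemma linear_plus_osc_has_mellin:
  assumes "Re s > 1"
  shows "(mellin_integrand (\<lambda>x. a * x + b * osc N x) s has_integral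
    of_real a / (s - 1) + of_real b * osc_mellin N s) {1..}"
proof -
  have "((\<lambda>x. mellin_integrand (\<lambda>x. a * x) s x + of_real b * mellin_integrand (osc N) s x) has_integral
      of_real a / (s - 1) + of_real b * osc_mellin N s) {1..}"
    by (intro has_integral_add has_integral_mult_right linear_has_mellin osc_has_mellin assms)
  then show ?thesis
    by (rule has_integral_eq[rotated]) (simp add: mellin_integrand_def algebra_simps)
qed

theorem theorem2:
  fixes \<rho> :: "real \<Rightarrow> real" and a \<alpha> :: real
  assumes "\<And>x. x \<ge> 1 \<Longrightarrow> \<rho> x > 0"
    and "a > 0"
    and "0 < \<alpha>" and "\<alpha> < 1"
    and "\<And>S :: real \<Rightarrow> real.
           mono_on {1..} S \<Longrightarrow>
           (\<And>s. Re s > 1 \<Longrightarrow> mellin_converges S s) \<Longrightarrow>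
           has_analytic_extension (\<lambda>s. mellin S s - of_real a / (s - 1))
             {s. Re s > 1} {s. Re s > \<alpha>} \<Longrightarrow>
           (\<lambda>x. S x - a * x) \<in> O[at_top](\<lambda>x. x * \<rho> x)"
  shows "hl_Omega \<rho> (\<lambda>_. 1) \<and> \<not> (\<rho> \<longlongrightarrow> 0) at_top"
proof -
  have not_lim: "\<not> (\<rho> \<longlongrightarrow> 0) at_top"
  proof
    assume lim: "(\<rho> \<longlongrightarrow> 0) at_top"
    from peaks_exceed_rate[OF lim assms(1)] obtain N
      where N: "osc N \<notin> O[at_top](\<lambda>x. x * \<rho> x)"
      by blast
    obtain D where D: "D > 0" "mono_on {1..} (\<lambda>x. D * x + osc N x)"
      using mono_on_linear_plus_osc by blast
    \<comment> \<open>Scaling D * x + osc N x by a / D makes the linear coefficient exactly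
      \<open>a\<close> and keeps monotonicity.\<close>
    define b where "b = a / D"
    have b: "b > 0" "b * D = a"
      using D(1) assms(2) by (auto simp: b_def)
    let ?S = "\<lambda>x. a * x + b * osc N x"
    note mel = linear_plus_osc_has_mellin[of _ a b N]
    have "(\<lambda>x. ?S x - a * x) \<in> O[at_top](\<lambda>x. x * \<rho> x)"
    proof (rule assms(5))
      have "mono_on {1..} (\<lambda>x. b * (D * x + osc N x))"
        using D(2) b(1) by (auto simp: mono_on_def intro!: mult_left_mono)
      moreover have "b * (D * x + osc N x) = ?S x" for x
        by (simp add: distrib_left flip: b(2))
      ultimately show "mono_on {1..} ?S"
        by simp
      show "mellin_converges ?S s" if "Re s > 1" for s
        unfolding mellin_converges_def using mel[OF that] by blast
      \<comment> \<open>The linear part of \<open>?S\<close> accounts for the whole pole term a / (s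
        - 1), so b * osc_mellin N is the required extension; it is analytic on Re s > 0, which
        contains Re s > \<alpha>.\<close>
      have "osc_mellin N holomorphic_on {s. Re s > \<alpha>}"
        by (rule holomorphic_on_subset[OF osc_mellin_holomorphic]) (use assms(3) in auto)
      then have "(\<lambda>s. of_real b * osc_mellin N s) analytic_on {s. Re s > \<alpha>}"
        by (simp add: analytic_on_open open_halfspace_Re_gt holomorphic_on_mult)
      moreover have "of_real b * osc_mellin N s = mellin ?S s - of_real a / (s - 1)" if "Re s > 1" for s
        unfolding mellin_def integral_unique[OF mel[OF that]] by simp
      moreover have "{s. Re s > 1} \<subseteq> {s. Re s > \<alpha>}"
        using assms(4) by auto
      ultimately show "has_analytic_extension (\<lambda>s. mellin ?S s - of_real a / (s - 1))
          {s. Re s > 1} {s. Re s > \<alpha>}"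
        unfolding has_analytic_extension_def by blast
    qed
    moreover have "(\<lambda>x. ?S x - a * x) = (\<lambda>x. b * osc N x)"
      by (rule ext) simp
    ultimately have "(\<lambda>x. b * osc N x) \<in> O[at_top](\<lambda>x. x * \<rho> x)"
      by (simp only:)
    then have "osc N \<in> O[at_top](\<lambda>x. x * \<rho> x)"
      using landau_o.big.cmult_in_iff[of b "osc N" at_top] b(1) by blast
    with N show False
      by contradiction
  qed
  moreover have "(\<rho> \<longlongrightarrow> 0) at_top" if "\<rho> \<in> o[at_top](\<lambda>_. 1)"
    using smalloD_tendsto[OF that] by simp
  ultimately show ?thesis
    unfolding hl_Omega_def by blast
qed

end
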